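(* Let $k>1$ be odd and let $G=D_{k^2+1}$ be the dihedral group of order $n=k^2+1$, generated by $s,r$ with $s^2=1$, $r^{n/2}=1$, $sr=r^{-1}s$. Let $A_1=\{r^i: 0\le i\le \tfrac{k-1}{2}\}\cup\{sr^j: 0\le j\le\tfrac{k-3}{2}\}$ and $A_2=\{r^{ik}: 1\le i\le\tfrac{k-1}{2}\}\cup\{sr^{jk+\frac{k-1}{2}}: 0\le j\le\tfrac{k-1}{2}\}$. Then $\{A_1,A_2\}$ is a $(k^2+1,2,k,1)$-SEDF in $G$. In particular, a $(k^2+1,2,k,1)$-SEDF exists in $D_{k^2+1}$.
   Context: Let $G$ be a group of order $n$ (written multiplicatively). An $(n,m,k,\lambda)$-SEDF in $G$ is a set of $m\ge2$ pairwise disjoint $k$-subsets $A_1,\ldots,A_m$ of $G$ such that for every $i$ the multiset $\{xy^{-1}: x\in A_i, y\in \bigcup_{j\neq i}A_j\}$ contains every non-identity element of $G$ exactly $\lambda$ times. $D_n$ denotes the dihedral group of order $n$, $D_n=\{s^ir^j: 0\le i\le1, 0\le j<n/2\}$. *)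

theory Defs
  imports "HOL-Algebra.Algebra" "HOL-Library.Multiset"
begin

definition external_quotients :: "('a, 'b) monoid_scheme \<Rightarrow> 'a set \<Rightarrow> 'a set \<Rightarrow> 'a multiset" where
  "external_quotients G A B = image_mset (\<lambda>(x, y). x \<otimes>\<^bsub>G\<^esub> inv\<^bsub>G\<^esub> y) (mset_set (A \<times> B))"

text \<open>
  \<open>\<A>\<close> is an \<open>(n, m, k, \<lambda>)\<close>-SEDF (strong external difference family) in \<open>G\<close>. Finiteness of
  \<open>G\<close> is explicit because \<^const>\<open>order\<close> is \<open>0\<close> on infinite groups and \<^const>\<open>mset_set\<close> is empty on
  infinite sets.
\<close>
definition is_SEDF ::
  "('a, 'b) monoid_scheme \<Rightarrow> nat \<Rightarrow> nat \<Rightarrow> nat \<Rightarrow> nat \<Rightarrow> 'a set set \<Rightarrow> bool" where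
  "is_SEDF G n m k l \<A> \<longleftrightarrow>
     group G \<and> finite (carrier G) \<and> order G = n \<and>
     2 \<le> m \<and> card \<A> = m \<and>
     (\<forall>A\<in>\<A>. A \<subseteq> carrier G \<and> card A = k) \<and>
     (\<forall>A\<in>\<A>. \<forall>B\<in>\<A>. A \<noteq> B \<longrightarrow> A \<inter> B = {}) \<and>
     (\<forall>A\<in>\<A>. \<forall>g\<in>carrier G - {\<one>\<^bsub>G\<^esub>}.
        count (external_quotients G A (\<Union>(\<A> - {A}))) g = l)"

text \<open>
  \<open>G\<close> is the dihedral group of order \<open>n\<close> (not of degree \<open>n\<close>) with standard generators \<open>s\<close>, \<open>r\<close>.
  A group generated by \<open>s\<close>, \<open>r\<close> subject to these relations is a quotient of the group they present,
  which has order \<open>n\<close>; the condition on the order therefore determines \<open>G\<close> up to isomorphism.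
\<close>
locale dihedral_group = group G for G (structure) +
  fixes n :: nat and s r :: 'a
  assumes n_pos: "0 < n" and n_even: "even n"
    and order_eq: "order G = n"
    and s_closed: "s \<in> carrier G" and r_closed: "r \<in> carrier G"
    and generated: "generate G {s, r} = carrier G"
    and s_square: "s [^] (2::nat) = \<one>"
    and r_power: "r [^] (n div 2) = \<one>"
    and s_r: "s \<otimes> r = inv r \<otimes> s"

text \<open>
  A model for every even order: the pair \<open>(i, j)\<close> with \<open>i \<in> {0, 1}\<close>, \<open>0 \<le> j < n/2\<close> stands for
  \<open>s\<^sup>i r\<^sup>j\<close>, so that \<open>s\<^sup>i r\<^sup>j s\<^bsup>i'\<^esup> r\<^bsup>j'\<^esup> = s\<^bsup>i+i'\<^esup> r\<^bsup>\<plusminus>j+j'\<^esup>\<close>.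
\<close>
definition dihedral_model :: "nat \<Rightarrow> (int \<times> int) monoid" where
  "dihedral_model n =
    \<lparr>carrier = {0..<2} \<times> {0..<int (n div 2)},
     monoid.mult = (\<lambda>(i, j) (i', j').
       ((i + i') mod 2, ((if i' = 0 then j else - j) + j') mod int (n div 2))),
     one = (0, 0)\<rparr>"

lemma dihedral_model_group:
  assumes "0 < n" "even n"
  shows "group (dihedral_model n)"
proof (rule groupI)
  have pos: "0 < int (n div 2)" using assms by auto
  have two: "i = 0 \<or> i = 1" if "0 \<le> i" "i < 2" for i :: int using that by auto
  show "\<one>\<^bsub>dihedral_model n\<^esub> \<in> carrier (dihedral_model n)"
    using pos by (simp add: dihedral_model_def)
  show "x \<otimes>\<^bsub>dihedral_model n\<^esub> y \<in> carrier (dihedral_model n)" for x y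
    using pos by (cases x; cases y) (simp add: dihedral_model_def)
  show "\<one>\<^bsub>dihedral_model n\<^esub> \<otimes>\<^bsub>dihedral_model n\<^esub> x = x"
    if "x \<in> carrier (dihedral_model n)" for x
    using that by (cases x) (simp add: dihedral_model_def)
  show "x \<otimes>\<^bsub>dihedral_model n\<^esub> y \<otimes>\<^bsub>dihedral_model n\<^esub> z
      = x \<otimes>\<^bsub>dihedral_model n\<^esub> (y \<otimes>\<^bsub>dihedral_model n\<^esub> z)"
    if "x \<in> carrier (dihedral_model n)" "y \<in> carrier (dihedral_model n)"
      "z \<in> carrier (dihedral_model n)" for x y z
  proof -
    obtain a b c d e f where xyz: "x = (a, b)" "y = (c, d)" "z = (e, f)"
      by (cases x; cases y; cases z) auto
    have "a = 0 \<or> a = 1" "c = 0 \<or> c = 1" "e = 0 \<or> e = 1"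
      using that two by (auto simp: xyz dihedral_model_def)
    then show ?thesis
      by (elim disjE) (simp_all add: xyz dihedral_model_def mod_simps algebra_simps)
  qed
  show "\<exists>y\<in>carrier (dihedral_model n). y \<otimes>\<^bsub>dihedral_model n\<^esub> x = \<one>\<^bsub>dihedral_model n\<^esub>"
    if "x \<in> carrier (dihedral_model n)" for x
  proof (cases x)
    case (Pair i j)
    show ?thesis
    proof (cases "i = 0")
      case True
      then show ?thesis using that pos Pair
        by (intro bexI[of _ "(0, (- j) mod int (n div 2))"])
          (auto simp: dihedral_model_def mod_simps)
    next
      case False
      then have "i = 1" using that Pair two by (auto simp: dihedral_model_def)
      then show ?thesis using that pos Pair
        by (intro bexI[of _ "(1, j)"]) (auto simp: dihedral_model_def)
    qed
  qed
qed

lemma dihedral_model: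
  assumes "0 < n" "even n"
  shows "dihedral_group (dihedral_model n) n (1, 0) (0, 1 mod int (n div 2))"
proof -
  let ?G = "dihedral_model n" and ?m = "int (n div 2)"
  let ?s = "(1, 0) :: int \<times> int" and ?r = "(0, 1 mod ?m) :: int \<times> int"
  interpret group ?G using dihedral_model_group[OF assms] .
  have pos: "0 < ?m" using assms by auto
  have s: "?s \<in> carrier ?G" and r: "?r \<in> carrier ?G"
    using pos by (auto simp: dihedral_model_def)
  have r_pow: "?r [^]\<^bsub>?G\<^esub> (j::nat) = (0, int j mod ?m)" for j
    by (induction j) (auto simp: nat_pow_def dihedral_model_def mod_simps algebra_simps)
  have "x \<in> generate ?G {?s, ?r}" if x: "x \<in> carrier ?G" for x
  proof -
    obtain i j where ij: "x = (i, j)" "0 \<le> i" "i < 2" "0 \<le> j" "j < ?m"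
      using x by (cases x) (auto simp: dihedral_model_def)
    have rj: "(0, j) \<in> generate ?G {?s, ?r}"
    proof -
      have "?r [^]\<^bsub>?G\<^esub> l \<in> generate ?G {?s, ?r}" for l :: nat
        by (induction l) (simp_all add: generate.one generate.eng generate.incl)
      from this[of "nat j"] show ?thesis using ij by (simp add: r_pow)
    qed
    have "(1, j) = ?s \<otimes>\<^bsub>?G\<^esub> (0, j)" using ij by (simp add: dihedral_model_def)
    also have "\<dots> \<in> generate ?G {?s, ?r}" by (intro generate.eng[OF _ rj] generate.incl) simp
    finally have "(1, j) \<in> generate ?G {?s, ?r}" .
    moreover have "i = 0 \<or> i = 1" using ij by auto
    ultimately show ?thesis using rj ij by auto
  qed
  then have gen: "generate ?G {?s, ?r} = carrier ?G"
    using s r by (auto dest: generate_in_carrier[rotated])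
  have rsr: "?r \<otimes>\<^bsub>?G\<^esub> (?s \<otimes>\<^bsub>?G\<^esub> ?r) = ?s"
    by (simp add: dihedral_model_def mod_simps)
  have "?s \<otimes>\<^bsub>?G\<^esub> ?r = inv\<^bsub>?G\<^esub> ?r \<otimes>\<^bsub>?G\<^esub> (?r \<otimes>\<^bsub>?G\<^esub> (?s \<otimes>\<^bsub>?G\<^esub> ?r))"
    using s r by (simp flip: m_assoc)
  then have "?s \<otimes>\<^bsub>?G\<^esub> ?r = inv\<^bsub>?G\<^esub> ?r \<otimes>\<^bsub>?G\<^esub> ?s" by (simp only: rsr)
  moreover have "order ?G = n" using assms by (auto simp: order_def dihedral_model_def)
  moreover have "?s [^]\<^bsub>?G\<^esub> (2::nat) = \<one>\<^bsub>?G\<^esub>"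
    using s by (simp add: numeral_2_eq_2) (simp add: dihedral_model_def)
  moreover have "?r [^]\<^bsub>?G\<^esub> (n div 2) = \<one>\<^bsub>?G\<^esub>"
    by (simp add: r_pow) (simp add: dihedral_model_def)
  ultimately show ?thesis using assms s r gen by unfold_locales auto
qed

end

theory Submission
  imports Defs
begin

text \<open>
  With two blocks of size at most \<open>k\<close> in a group of order \<open>k\<^sup>2 + 1\<close> there are at most \<open>k\<^sup>2\<close> quotients,
  so as soon as they cover the \<open>k\<^sup>2\<close> non-identity elements, each occurs exactly once; sizes and
  disjointness of the blocks then come for free. For the dihedral group write \<open>k = 2h + 1\<close>, so that
  \<open>n/2 = hk + h + 1\<close>. Covering is division by \<open>k\<close> with remainder: for \<open>t = qk + u < n/2\<close> the
  remainder \<open>u\<close> decides which of the two parts (rotations, reflections) of \<open>A\<^sub>2\<close> is used for \<open>r\<^sup>t\<close>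
  and for \<open>s r\<^sup>t\<close>; the block multiplier \<open>k\<close> then cancels \<open>qk\<close>, directly for reflections and modulo
  \<open>n/2\<close> for rotations.
\<close>

context group
begin

text \<open>Pigeonhole: by \<open>covers\<close> and the cardinality bound,
  \<open>(x, y) \<mapsto> x \<otimes> inv y\<close> maps \<open>A \<times> B\<close> onto exactly
  the non-identity elements, with no room for a collision, so it is injective. A common element of
  \<open>A\<close> and \<open>B\<close> would put \<open>\<one>\<close> in the image.\<close>

lemma count_external_quotients_eq_1:
  assumes "A \<subseteq> carrier G" "finite A" "B \<subseteq> carrier G" "finite B"
    and "card A * card B \<le> card (carrier G - {\<one>})"
    and covers: "carrier G - {\<one>} \<subseteq> (\<lambda>(x, y). x \<otimes> inv y) ` (A \<times> B)"
    and "g \<in> carrier G - {\<one>}"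
  shows "A \<inter> B = {}" "count (external_quotients G A B) g = 1"
proof -
  let ?f = "\<lambda>(x, y). x \<otimes> inv y"
  have fin: "finite (A \<times> B)" using assms by simp
  have "card (?f ` (A \<times> B)) \<le> card (carrier G - {\<one>})"
    using card_image_le[OF fin, of ?f] assms by (simp add: card_cartesian_product)
  then have image: "?f ` (A \<times> B) = carrier G - {\<one>}"
    using covers fin by (metis card_seteq finite_imageI)
  show "A \<inter> B = {}"
  proof (rule ccontr)
    assume "A \<inter> B \<noteq> {}"
    then obtain x where "x \<in> A" "x \<in> B" by auto
    then have "\<one> \<in> ?f ` (A \<times> B)" using assms(1) by (force intro: image_eqI[of _ _ "(x, x)"])
    then show False using image by simp
  qed
  have "card (A \<times> B) \<le> card (?f ` (A \<times> B))"
    using assms image by (simp add: card_cartesian_product)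
  then have "inj_on ?f (A \<times> B)"
    using fin by (simp add: card_image_le eq_card_imp_inj_on le_antisym)
  then have "external_quotients G A B = mset_set (carrier G - {\<one>})"
    by (simp add: external_quotients_def image_mset_mset_set image)
  moreover have "finite (carrier G - {\<one>})"
    using fin image by (metis finite_imageI)
  ultimately show "count (external_quotients G A B) g = 1" using assms(7) by simp
qed

text \<open>One covering suffices: inverting \<open>x \<otimes> inv y\<close> swaps the roles of the
  blocks. The form \<open>g \<otimes> y = x\<close> keeps inverses out of the later calculations
  with powers of \<open>r\<close>.\<close>

lemma is_SEDF_of_covering:
  assumes ord: "order G = k\<^sup>2 + 1" and "0 < k"
    and A: "A \<subseteq> carrier G" "card A \<le> k" and B: "B \<subseteq> carrier G" "card B \<le> k"
    and covers: "\<And>g. g \<in> carrier G \<Longrightarrow> g \<noteq> \<one> \<Longrightarrow> \<exists>x\<in>A. \<exists>y\<in>B. g \<otimes> y = x"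
  shows "is_SEDF G (k\<^sup>2 + 1) 2 k 1 {A, B}"
proof -
  have fin: "finite (carrier G)" using ord order_gt_0_iff_finite by fastforce
  then have finAB: "finite A" "finite B" using A B finite_subset by auto
  have card: "card (carrier G - {\<one>}) = k\<^sup>2" using ord fin by (simp add: order_def)
  have AB: "carrier G - {\<one>} \<subseteq> (\<lambda>(x, y). x \<otimes> inv y) ` (A \<times> B)"
  proof
    fix g assume g: "g \<in> carrier G - {\<one>}"
    then obtain x y where xy: "x \<in> A" "y \<in> B" "g \<otimes> y = x" using covers by blast
    then have "g = x \<otimes> inv y" using g A B by (metis DiffD1 inv_solve_right subsetD)
    then show "g \<in> (\<lambda>(x, y). x \<otimes> inv y) ` (A \<times> B)" using xy by auto
  qed
  have BA: "carrier G - {\<one>} \<subseteq> (\<lambda>(x, y). x \<otimes> inv y) ` (B \<times> A)"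
  proof
    fix g assume g: "g \<in> carrier G - {\<one>}"
    then have "inv g \<in> carrier G - {\<one>}" by (simp add: inv_eq_1_iff)
    then have "inv g \<in> (\<lambda>(x, y). x \<otimes> inv y) ` (A \<times> B)" using AB by (rule rev_subsetD)
    then obtain x y where xy: "x \<in> A" "y \<in> B" "inv g = x \<otimes> inv y" by auto
    then have "g = y \<otimes> inv x" using g A B
      by (metis DiffD1 inv_closed inv_inv inv_mult_group subsetD)
    then show "g \<in> (\<lambda>(x, y). x \<otimes> inv y) ` (B \<times> A)" using xy by auto
  qed
  have le: "card A * card B \<le> k\<^sup>2" "card A * card B \<le> card A * k" "card A * card B \<le> k * card B"
    using A B by (simp_all add: power2_eq_square mult_le_mono)
  have "k\<^sup>2 \<le> card ((\<lambda>(x, y). x \<otimes> inv y) ` (A \<times> B))"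
    using card_mono[OF _ AB] finAB card by simp
  also have "\<dots> \<le> card A * card B"
    using card_image_le[of "A \<times> B"] finAB by (metis card_cartesian_product finite_cartesian_product)
  finally have ge: "k\<^sup>2 \<le> card A * card B" .
  have "k * k \<le> card A * k" "k * k \<le> k * card B"
    using le ge by (simp_all add: power2_eq_square)
  then have cards: "card A = k" "card B = k"
    using A B \<open>0 < k\<close> by (simp_all add: mult_le_cancel1 mult_le_cancel2)
  have g: "g \<in> carrier G - {\<one>} \<Longrightarrow> A \<inter> B = {} \<and> count (external_quotients G A B) g = 1
      \<and> count (external_quotients G B A) g = 1" for g
    using count_external_quotients_eq_1[of A B g] count_external_quotients_eq_1[of B A g]
      A B finAB AB BA card le by (auto simp: mult.commute)
  \<comment> \<open>\<open>g\<close> yields disjointness only in the presence of some non-identity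
    element.\<close>
  have "carrier G - {\<one>} \<noteq> {}"
    using card \<open>0 < k\<close> by (metis card.empty less_numeral_extra(3) zero_less_power)
  then have disj: "A \<inter> B = {}" using g by blast
  then have "A \<noteq> B" using cards \<open>0 < k\<close> by auto
  then have diff: "{A, B} - {A} = {B}" "{A, B} - {B} = {A}" by auto
  show ?thesis
    unfolding is_SEDF_def ball_simps diff
    using fin ord A(1) B(1) cards disj \<open>A \<noteq> B\<close> g is_group
    by (simp add: Int_commute)
qed

end

context dihedral_group
begin

text \<open>The relation \<open>s_r\<close> in the inverse-free form
  \<open>r \<otimes> (s \<otimes> r) = s\<close>, iterated from the inside out; all exponents stay
  natural numbers.\<close>

lemma r_pow_s_r_pow: "r [^] (t::nat) \<otimes> (s \<otimes> r [^] t) = s"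
proof (induction t)
  case (Suc t)
  have rsr: "r \<otimes> (s \<otimes> r) = s"
    using s_r s_closed r_closed by (simp flip: m_assoc)
  have "r [^] Suc t \<otimes> (s \<otimes> r [^] Suc t) = (r \<otimes> r [^] t) \<otimes> (s \<otimes> (r [^] t \<otimes> r))"
    using nat_pow_Suc2[OF r_closed, of t] by simp
  also have "\<dots> = r \<otimes> (r [^] t \<otimes> (s \<otimes> r [^] t)) \<otimes> r"
    using s_closed r_closed by (simp add: m_assoc)
  finally have "r [^] Suc t \<otimes> (s \<otimes> r [^] Suc t) = r \<otimes> (r [^] t \<otimes> (s \<otimes> r [^] t)) \<otimes> r" .
  then show ?case using Suc rsr s_closed r_closed by (simp add: m_assoc)
qed (use s_closed in simp)

lemma r_pow_s_r_pow_add: "r [^] (t::nat) \<otimes> (s \<otimes> r [^] (t + i)) = s \<otimes> r [^] (i::nat)"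
proof -
  have "r [^] t \<otimes> (s \<otimes> r [^] (t + i)) = (r [^] t \<otimes> (s \<otimes> r [^] t)) \<otimes> r [^] i"
    using s_closed r_closed by (simp add: m_assoc nat_pow_mult)
  then show ?thesis by (simp add: r_pow_s_r_pow)
qed

lemma r_pow_half_mult: "r [^] ((n div 2) * t) = \<one>" for t :: nat
  by (metis nat_pow_one nat_pow_pow r_closed r_power)

lemma r_pow_add_half: "r [^] (t + n div 2) = r [^] t" for t :: nat
  using r_closed r_power by (simp flip: nat_pow_mult)

lemma r_pow_mod: "r [^] (t mod (n div 2)) = r [^] t" for t :: nat
proof -
  have "r [^] t = r [^] ((n div 2) * (t div (n div 2)) + t mod (n div 2))" by simp
  also have "\<dots> = r [^] (t mod (n div 2))"
    unfolding nat_pow_mult[OF r_closed, symmetric] r_pow_half_mult using r_closed by simp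
  finally show ?thesis by simp
qed

lemma s_s: "s \<otimes> s = \<one>"
  using s_square s_closed by (simp add: numeral_2_eq_2)

lemma r_pow_s: "\<exists>b::nat. r [^] (a::nat) \<otimes> s = s \<otimes> r [^] b"
proof -
  \<comment> \<open>A natural number congruent to \<open>- a\<close> modulo
    \<open>n div 2\<close>.\<close>
  let ?b = "(n div 2 - 1) * a"
  have "a + ?b = (n div 2) * a" using n_pos n_even by (cases "n div 2") auto
  then have "r [^] a \<otimes> r [^] ?b = \<one>"
    using r_closed r_pow_half_mult by (simp add: nat_pow_mult)
  then have "r [^] a \<otimes> s = r [^] a \<otimes> s \<otimes> (r [^] a \<otimes> r [^] ?b)"
    using s_closed r_closed by simp
  also have "\<dots> = (r [^] a \<otimes> (s \<otimes> r [^] a)) \<otimes> r [^] ?b"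
    using s_closed r_closed by (simp add: m_assoc)
  finally show ?thesis by (auto simp: r_pow_s_r_pow)
qed

text \<open>The set \<open>?S\<close> of normal forms is closed under products and contains
  \<open>\<one>\<close>, both generators and their inverses, hence everything they generate;
  exponents are then reduced modulo \<open>n div 2\<close>.\<close>

lemma carrier_cases:
  assumes "g \<in> carrier G"
  obtains t where "t < n div 2" "g = r [^] t" | t where "t < n div 2" "g = s \<otimes> r [^] t"
proof -
  let ?S = "range (\<lambda>t::nat. r [^] t) \<union> range (\<lambda>t::nat. s \<otimes> r [^] t)"
  have r_s: "r [^] a \<otimes> (s \<otimes> r [^] b) \<in> range (\<lambda>t::nat. s \<otimes> r [^] t)"
    "s \<otimes> r [^] a \<otimes> (s \<otimes> r [^] b) \<in> range (\<lambda>t::nat. r [^] t)" for a b :: nat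
  proof -
    obtain c :: nat where c: "r [^] a \<otimes> s = s \<otimes> r [^] c" using r_pow_s by blast
    have *: "r [^] a \<otimes> (s \<otimes> r [^] b) = s \<otimes> r [^] (c + b)"
      using s_closed r_closed c by (simp add: m_assoc[symmetric]) (simp add: m_assoc nat_pow_mult)
    then show "r [^] a \<otimes> (s \<otimes> r [^] b) \<in> range (\<lambda>t::nat. s \<otimes> r [^] t)" by blast
    have "s \<otimes> r [^] a \<otimes> (s \<otimes> r [^] b) = s \<otimes> (s \<otimes> r [^] (c + b))"
      using s_closed r_closed * by (simp add: m_assoc)
    also have "\<dots> = r [^] (c + b)" using s_closed r_closed by (simp add: s_s flip: m_assoc)
    finally show "s \<otimes> r [^] a \<otimes> (s \<otimes> r [^] b) \<in> range (\<lambda>t::nat. r [^] t)" by blast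
  qed
  have mult: "x \<otimes> y \<in> ?S" if "x \<in> ?S" "y \<in> ?S" for x y
    using that r_s r_closed s_closed by (auto simp: nat_pow_mult m_assoc)
  have "\<one> \<in> ?S" by (auto intro: range_eqI[of _ _ "0::nat"])
  have "r \<in> ?S" using r_closed by (auto intro: range_eqI[of _ _ "1::nat"])
  have "s \<in> ?S" using s_closed by (auto intro: range_eqI[of _ _ "0::nat"])
  have "inv s = s" using s_s s_closed inv_equality by blast
  have "r [^] (n div 2 - 1) \<otimes> r = \<one>"
    using n_pos n_even r_power by (cases "n div 2") auto
  then have "inv r \<in> ?S" using r_closed by (metis UnI1 inv_equality nat_pow_closed rangeI)
  have "x \<in> ?S" if "x \<in> generate G {s, r}" for x
    using that
    by induction (use mult \<open>\<one> \<in> ?S\<close> \<open>r \<in> ?S\<close> \<open>s \<in> ?S\<close> \<open>inv r \<in> ?S\<close> \<open>inv s = s\<close> in auto)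
  then have "g \<in> ?S" using assms generated by simp
  then obtain t :: nat where "g = r [^] t \<or> g = s \<otimes> r [^] t" by blast
  moreover have "t mod (n div 2) < n div 2" using n_pos n_even by auto
  ultimately show thesis using that r_pow_mod by metis
qed

end

theorem theorem6p2:
  fixes G (structure) and s r :: 'a and k :: nat and A1 A2 :: "'a set"
  assumes "1 < k" and "odd k"
    and "dihedral_group G (k\<^sup>2 + 1) s r"
    and "A1 = {r [^] i | i :: nat. i \<le> (k - 1) div 2}
            \<union> {s \<otimes> r [^] j | j :: nat. j \<le> (k - 3) div 2}"
    and "A2 = {r [^] (i * k) | i :: nat. 1 \<le> i \<and> i \<le> (k - 1) div 2}
            \<union> {s \<otimes> r [^] (j * k + (k - 1) div 2) | j :: nat. j \<le> (k - 1) div 2}"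
  shows "is_SEDF G (k\<^sup>2 + 1) 2 k 1 {A1, A2} \<and> (\<exists>\<A>. is_SEDF G (k\<^sup>2 + 1) 2 k 1 \<A>)"
proof -
  interpret dihedral_group G "k\<^sup>2 + 1" s r by fact
  note [simp] = s_closed r_closed
  obtain h where k: "k = 2 * h + 1" using \<open>odd k\<close> by (elim oddE)
  have h: "0 < h" "(k - 1) div 2 = h" "(k - 3) div 2 = h - 1" using \<open>1 < k\<close> k by auto
  have half: "(k\<^sup>2 + 1) div 2 = h * k + h + 1" by (simp add: k power2_eq_square algebra_simps)
  have lt: "j \<le> h - 1 \<longleftrightarrow> j < h" for j using h(1) by auto
  have A1: "A1 = (\<lambda>i. r [^] i) ` {..h} \<union> (\<lambda>j. s \<otimes> r [^] j) ` {..<h}"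
    unfolding assms(4) h lt setcompr_eq_image atMost_def lessThan_def ..
  have A2: "A2 = (\<lambda>i. r [^] (i * k)) ` {1..h} \<union> (\<lambda>j. s \<otimes> r [^] (j * k + h)) ` {..h}"
    unfolding assms(5) h setcompr_eq_image atMost_def atLeastAtMost_def atLeast_def
      Collect_conj_eq ..
  \<comment> \<open>Each block is a union of images of index sets of sizes \<open>h + 1\<close> and
    \<open>h\<close>, in one order or the other. Upper bounds are enough, so no powers of
    \<open>r\<close> need be shown distinct.\<close>
  have card: "card A1 \<le> k" "card A2 \<le> k"
    unfolding A1 A2 k
    by (rule order_trans[OF card_Un_le],
        rule order_trans[OF add_mono[OF card_image_le card_image_le]], simp_all)+
  \<comment> \<open>Multiplication by a rotation from \<open>A2\<close> whose exponent sum wraps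
    around \<open>n/2\<close> exactly once.\<close>
  have shift: "r [^] t \<otimes> r [^] (i * k) = r [^] u"
    if "t + i * k = u + (h * k + h + 1)" for t i u :: nat
    using r_pow_add_half[of u] unfolding half nat_pow_mult[OF r_closed] that .
  have "\<exists>x\<in>A1. \<exists>y\<in>A2. g \<otimes> y = x" if g: "g \<in> carrier G" "g \<noteq> \<one>" for g
  proof -
    have rot: "r [^] i \<in> A1" if "i \<le> h" for i using that by (auto simp: A1)
    have ref: "s \<otimes> r [^] i \<in> A1" if "i < h" for i using that by (auto simp: A1)
    have rot': "r [^] (i * k) \<in> A2" if "1 \<le> i" "i \<le> h" for i using that by (auto simp: A2)
    have ref': "s \<otimes> r [^] (i * k + h) \<in> A2" if "i \<le> h" for i using that by (auto simp: A2)
    obtain t where t_less: "t < h * k + h + 1" and gt: "g = r [^] t \<or> g = s \<otimes> r [^] t"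
      using carrier_cases[OF g(1)] half by metis
    define q u where "q = t div k" and "u = t mod k"
    have t: "t = q * k + u" and "u < k"
      unfolding q_def u_def using \<open>1 < k\<close> by simp_all
    \<comment> \<open>Otherwise \<open>t\<close> is at least
      \<open>(h + 1) * k = h * k + 2 * h + 1\<close>, beyond its bound.\<close>
    have "q \<le> h"
    proof (rule ccontr)
      assume "\<not> q \<le> h"
      then have "(h + 1) * k \<le> q * k" by (intro mult_le_mono1) simp
      then show False using t t_less k by simp
    qed
    then have hk: "q * k + (h - q) * k = h * k" by (simp flip: add_mult_distrib)
    show ?thesis
    \<comment> \<open>For \<open>u \<le> h\<close> the reflection with exponent
      \<open>q * k + h = t + (h - u)\<close> takes \<open>r [^] t\<close> to
      \<open>s \<otimes> r [^] (h - u)\<close> and \<open>s \<otimes> r [^] t\<close> to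
      \<open>r [^] (h - u)\<close>.\<close>
    proof (cases "u \<le> h")
      case True
      then have y: "q * k + h = t + (h - u)" by (simp add: t)
      from gt show ?thesis
      proof
        assume g_rot: "g = r [^] t"
        show ?thesis
        \<comment> \<open>For \<open>u = 0\<close> the result \<open>s \<otimes> r [^] h\<close>
          just misses \<open>A1\<close>. A rotation replaces it:
          \<open>q * k + (h - (q - 1)) * k = (h + 1) * k\<close> is \<open>h\<close> plus
          \<open>n/2\<close>. The index is at most \<open>h\<close> because
          \<open>g \<noteq> \<one>\<close> forces \<open>0 < q\<close>.\<close>
        proof (cases "u = 0")
          case True
          then have "0 < q" using t g g_rot by (cases q) auto
          then have "t + (h - (q - 1)) * k = h + (h * k + h + 1)"
            using \<open>q \<le> h\<close> hk True t k by (simp add: Suc_diff_le)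
          then show ?thesis
            using g_rot shift rot[of h] rot'[of "h - (q - 1)"] \<open>0 < q\<close> \<open>q \<le> h\<close> by fastforce
        next
          case False
          then show ?thesis
            using g_rot r_pow_s_r_pow_add[of t "h - u"] ref[of "h - u"] ref'[of q] \<open>q \<le> h\<close> h y by auto
        qed
      next
        assume "g = s \<otimes> r [^] t"
        then have "g \<otimes> (s \<otimes> r [^] (q * k + h)) = r [^] (h - u)"
          using r_pow_s_r_pow_add[of t "h - u"] by (simp add: y m_assoc) (simp add: s_s flip: m_assoc)
        then show ?thesis using rot[of "h - u"] ref'[of q] \<open>q \<le> h\<close> by auto
      qed
    next
      case False
      \<comment> \<open>With \<open>q = h\<close> and \<open>u > h\<close>, \<open>t\<close> would
        reach \<open>h * k + h + 1\<close>. Hence \<open>h - q\<close> is a valid index of a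
        rotation in \<open>A2\<close>.\<close>
      then have "q < h" using t t_less \<open>q \<le> h\<close> by (cases "q = h") auto
      have "t + (h - q) * k = (u - h - 1) + (h * k + h + 1)" using False hk t by simp
      note shift[OF this]
      \<comment> \<open>Since \<open>u \<le> 2 * h\<close>, the exponent is below \<open>h\<close>
        and fits both parts of \<open>A1\<close>, so one rotation serves both forms of
        \<open>g\<close>.\<close>
      moreover have "r [^] (u - h - 1) \<in> A1" "s \<otimes> r [^] (u - h - 1) \<in> A1"
        using rot ref \<open>u < k\<close> False k by simp_all
      moreover have "r [^] ((h - q) * k) \<in> A2" using rot' \<open>q < h\<close> by simp
      ultimately show ?thesis using gt by (metis m_assoc nat_pow_closed r_closed s_closed)
    qed
  qed
  then have "is_SEDF G (k\<^sup>2 + 1) 2 k 1 {A1, A2}"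
    using \<open>1 < k\<close> order_eq card by (intro is_SEDF_of_covering) (auto simp: A1 A2)
  then show ?thesis by blast
qed

end
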